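(* For all $n \ge 3$, the characteristic polynomials $f_n(\lambda) = \det(A_n - \lambda I_n)$ satisfy the three-term recurrence relation $$f_n(\lambda) = -\lambda f_{n-1}(\lambda) - f_{n-2}(\lambda),$$ with initial conditions $f_1(\lambda) = -\lambda$ and $f_2(\lambda) = \lambda^2 - 1$.
   Context: For $n \in \mathbb{N} = \{1,2,3,\ldots\}$, $A_n$ denotes the $n \times n$ real symmetric tridiagonal matrix whose diagonal entries are all $0$, whose superdiagonal and subdiagonal entries are all $1$, and whose other entries are all $0$ (so $A_1 = [0]$). $I_n$ is the $n\times n$ identity matrix. The characteristic polynomial of $A_n$ is, by convention, $f_n(\lambda) = \det(A_n - \lambda I_n)$. *)

theory Defs
  imports "Jordan_Normal_Form.Char_Poly"
begin

text \<open>Indices run over \<open>0..<n\<close>.\<close>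

definition path_mat :: "nat \<Rightarrow> real mat" where
  "path_mat n = mat n n (\<lambda>(i, j). if j = i + 1 \<or> i = j + 1 then 1 else 0)"

text \<open>
  The sign convention is \<open>det (A - \<lambda> I)\<close>; the library's \<^const>\<open>char_poly\<close> is \<open>det (\<lambda> I - A)\<close>,
  which differs by the factor \<open>(-1)^n\<close>. The indeterminate \<open>\<lambda>\<close> is \<open>[:0, 1:]\<close>.
\<close>

definition char_poly_minus :: "real mat \<Rightarrow> real poly" where
  "char_poly_minus A =
     det (map_mat (\<lambda>a. [:a:]) A - [:0, 1:] \<cdot>\<^sub>m 1\<^sub>m (dim_row A))"

lemma poly_char_poly_minus:
  assumes A: "A \<in> carrier_mat n n"
  shows "poly (char_poly_minus A) x = det (A - x \<cdot>\<^sub>m 1\<^sub>m n)"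
proof -
  have "poly (char_poly_minus A) x =
      det (map_mat (\<lambda>p. poly p x) (map_mat (\<lambda>a. [:a:]) A - [:0, 1:] \<cdot>\<^sub>m 1\<^sub>m (dim_row A)))"
    unfolding char_poly_minus_def
    by (rule comm_ring_hom.hom_det[OF poly_hom.comm_ring_hom_axioms, symmetric])
  also have "map_mat (\<lambda>p. poly p x) (map_mat (\<lambda>a. [:a:]) A - [:0, 1:] \<cdot>\<^sub>m 1\<^sub>m (dim_row A))
      = A - x \<cdot>\<^sub>m 1\<^sub>m n"
    using A by (intro eq_matI) auto
  finally show ?thesis .
qed

definition f_poly :: "nat \<Rightarrow> real poly" where
  "f_poly n = char_poly_minus (path_mat n)"

end

theory Submission
  imports Defs
begin

text \<open>
  Expand the determinant along its first row, and then the minor of the entry \<open>(0, 1)\<close> along its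
  first column: each of these has at most two, respectively one, nonzero entries.
\<close>

text \<open>The diagonal entry is a parameter in an arbitrary commutative ring, so that it can be
  taken to be the polynomial \<open>- [:0, 1:]\<close>.\<close>

definition toeplitz_tridiag :: "'a :: comm_ring_1 \<Rightarrow> nat \<Rightarrow> 'a mat" where
  "toeplitz_tridiag a n =
     mat n n (\<lambda>(i, j). if i = j then a else if j = i + 1 \<or> i = j + 1 then 1 else 0)"

lemma toeplitz_tridiag_carrier [simp]: "toeplitz_tridiag a n \<in> carrier_mat n n"
  by (simp add: toeplitz_tridiag_def)

text \<open>Entries depend only on \<open>i - j\<close>, which is unchanged when both indices shift
  by one.\<close>

lemma mat_delete_toeplitz_tridiag:
  "mat_delete (toeplitz_tridiag a (Suc n)) 0 0 = toeplitz_tridiag a n"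
  by (intro eq_matI) (auto simp: mat_delete_def toeplitz_tridiag_def)

text \<open>Column 0 survives the deletion without its top entry \<open>a\<close>, so it starts with
  the subdiagonal 1 and is zero below. Removing it together with the top row of the minor leaves the
  original matrix without its first two rows and columns.\<close>

lemma det_minor_toeplitz_tridiag:
  "det (mat_delete (toeplitz_tridiag a (Suc (Suc n))) 0 1) = det (toeplitz_tridiag a n)"
proof -
  define B where "B = mat_delete (toeplitz_tridiag a (Suc (Suc n))) 0 1"
  have B: "B \<in> carrier_mat (Suc n) (Suc n)"
    by (simp add: B_def mat_delete_def toeplitz_tridiag_def)
  have col: "B $$ (i, 0) = (if i = 0 then 1 else 0)" if "i < Suc n" for i
    using that by (simp add: B_def mat_delete_def toeplitz_tridiag_def)
  have minor: "mat_delete B 0 0 = toeplitz_tridiag a n"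
    by (intro eq_matI) (auto simp: B_def mat_delete_def toeplitz_tridiag_def)
  have "det B = (\<Sum>i<Suc n. B $$ (i, 0) * cofactor B i 0)"
    by (rule laplace_expansion_column[OF B]) simp
  also have "\<dots> = cofactor B 0 0"
    by (simp only: sum.lessThan_Suc_shift) (simp add: col)
  finally show ?thesis
    unfolding B_def[symmetric] by (simp add: cofactor_def minor)
qed

lemma det_toeplitz_tridiag_0: "det (toeplitz_tridiag a 0) = 1"
  by (simp add: toeplitz_tridiag_def)

lemma det_toeplitz_tridiag_1: "det (toeplitz_tridiag a (Suc 0)) = a"
  by (subst det_single) (auto simp: toeplitz_tridiag_def)

lemma det_toeplitz_tridiag_Suc_Suc:
  "det (toeplitz_tridiag a (Suc (Suc n))) =
     a * det (toeplitz_tridiag a (Suc n)) - det (toeplitz_tridiag a n)"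
proof -
  define A where "A = toeplitz_tridiag a (Suc (Suc n))"
  have row: "A $$ (0, j) = (if j = 0 then a else if j = 1 then 1 else 0)"
    if "j < Suc (Suc n)" for j
    using that by (simp add: A_def toeplitz_tridiag_def)
  have "det A = (\<Sum>j<Suc (Suc n). A $$ (0, j) * cofactor A 0 j)"
    by (rule laplace_expansion_row) (simp_all add: A_def)
  \<comment> \<open>Two terms are split off the front of the sum; all later ones vanish by
    \<open>row\<close>.\<close>
  also have "\<dots> = a * cofactor A 0 0 + cofactor A 0 1"
    by (simp only: sum.lessThan_Suc_shift) (simp add: row)
  also have "\<dots> = a * det (toeplitz_tridiag a (Suc n)) - det (toeplitz_tridiag a n)"
    \<comment> \<open>The minus sign is the cofactor sign at position (0, 1).\<close>
    using det_minor_toeplitz_tridiag[of a n]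
    by (simp add: cofactor_def A_def mat_delete_toeplitz_tridiag)
  finally show ?thesis by (simp add: A_def)
qed

lemma f_poly_eq_det_toeplitz_tridiag: "f_poly n = det (toeplitz_tridiag (- [:0, 1:]) n)"
proof -
  have "map_mat (\<lambda>a. [:a:]) (path_mat n) - [:0, 1:] \<cdot>\<^sub>m 1\<^sub>m (dim_row (path_mat n))
      = toeplitz_tridiag (- [:0, 1:]) n"
    \<comment> \<open>\<open>one_pCons\<close> identifies the off-diagonal constants
      \<open>[:1:]\<close> with the ring element 1.\<close>
    by (intro eq_matI) (auto simp: path_mat_def toeplitz_tridiag_def one_pCons)
  then show ?thesis
    by (simp add: f_poly_def char_poly_minus_def)
qed

lemma f_poly_Suc_Suc: "f_poly (Suc (Suc n)) = - [:0, 1:] * f_poly (Suc n) - f_poly n"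
  unfolding f_poly_eq_det_toeplitz_tridiag by (rule det_toeplitz_tridiag_Suc_Suc)

theorem mainTheorem2:
  shows "(\<forall>n\<ge>3. f_poly n = - [:0, 1:] * f_poly (n - 1) - f_poly (n - 2))
    \<and> f_poly 1 = - [:0, 1:]
    \<and> f_poly 2 = [:0, 1:] ^ 2 - 1"
proof (intro conjI allI impI)
  fix n :: nat
  assume "n \<ge> 3"
  then obtain m where "n = Suc (Suc m)"
    by (metis Suc_le_D numeral_3_eq_3 Suc_le_mono)
  then show "f_poly n = - [:0, 1:] * f_poly (n - 1) - f_poly (n - 2)"
    using f_poly_Suc_Suc[of m] by simp
next
  show f1: "f_poly 1 = - [:0, 1:]"
    unfolding f_poly_eq_det_toeplitz_tridiag One_nat_def by (rule det_toeplitz_tridiag_1)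
  \<comment> \<open>The empty determinant is 1. The recurrence already holds from size 2 on, so this
    value yields \<open>f_poly 2\<close> without a separate 2 by 2 computation.\<close>
  have f0: "f_poly 0 = 1"
    unfolding f_poly_eq_det_toeplitz_tridiag by (rule det_toeplitz_tridiag_0)
  have "f_poly 2 = - [:0, 1:] * f_poly 1 - f_poly 0"
    using f_poly_Suc_Suc[of 0] by (simp add: numeral_2_eq_2)
  then show "f_poly 2 = [:0, 1:] ^ 2 - 1"
    unfolding f0 f1 by (simp add: power2_eq_square)
qed

end
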